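(* Let $\alpha,\beta\in(0,1)$ and $\mu,\lambda_1,\beta_1,\lambda>0$. The tempered space-time fractional negative binomial process $\mathcal{Q}(t)=N_\beta(M_{\alpha,\beta_1,\lambda_1,\mu}(t),\lambda)$ is overdispersed, i.e. $$\mathrm{Var}[\mathcal{Q}(t)]-\mathbb{E}[\mathcal{Q}(t)]>0\qquad\text{for all } t>0.$$
   Context: Tempered Mittag-Leffler Lévy process: $M_{\alpha,\beta_1,\lambda_1,\mu}(t):=S_{\alpha,\mu}(G_{\lambda_1,\beta_1}(t))$, $t\ge0$, where $S_{\alpha,\mu}$ and $G_{\lambda_1,\beta_1}$ are independent; $G_{\lambda_1,\beta_1}(t)$ is the gamma subordinator (Lévy process) with density $\frac{\lambda_1^{\beta_1 t}}{\Gamma(\beta_1 t)}x^{\beta_1 t-1}e^{-\lambda_1 x}$, $x>0$; and $S_{\alpha,\mu}(t)$ is the tempered $\alpha$-stable subordinator with density $e^{-\mu x+\mu^\alpha t}g_\alpha(x,t)$, $x>0$, where $g_\alpha(\cdot,t)$ is the density of the $\alpha$-stable subordinator with Laplace transform $e^{-tu^\alpha}$. Fractional Poisson process (FPP): for $0<\beta<1$, $N_\beta(t,\lambda)=N(\mathcal{E}_\beta(t))$, where $N$ is a Poisson process with rate $\lambda$ and $\mathcal{E}_\beta(t)=\inf\{r\ge 0: D_\beta(r)>t\}$ is an independent inverse stable subordinator, $D_\beta$ being the $\beta$-stable subordinator with $\mathbb{E}[e^{-uD_\beta(r)}]=e^{-ru^\beta}$. Tempered space-time fractional negative binomial process (TSTFNBP):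 $N_\beta(M_{\alpha,\beta_1,\lambda_1,\mu}(t),\lambda)$, $t\ge0$, with $N_\beta$ and $M_{\alpha,\beta_1,\lambda_1,\mu}$ independent. *)

theory Defs
  imports "HOL-Probability.Probability"
begin

text \<open>
  Processes are families \<open>X :: real \<Rightarrow> 'a \<Rightarrow> _\<close> on a probability space; only the
  times \<open>t \<ge> 0\<close> are meaningful. Path properties are required for every \<open>\<omega>\<close> rather than
  almost every one, so that time changes of processes are measurable also when the
  probability space is not complete.
\<close>

definition cadlag :: "(real \<Rightarrow> real) \<Rightarrow> bool" where
  "cadlag f \<longleftrightarrow>
     (\<forall>t\<ge>0. (f \<longlongrightarrow> f t) (at_right t)) \<and>
     (\<forall>t>0. \<exists>l. (f \<longlongrightarrow> l) (at_left t))"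

definition time_change :: "(real \<Rightarrow> 'a \<Rightarrow> 'b) \<Rightarrow> (real \<Rightarrow> 'a \<Rightarrow> real) \<Rightarrow> real \<Rightarrow> 'a \<Rightarrow> 'b" where
  "time_change X T t \<omega> = X (T t \<omega>) \<omega>"

text \<open>
  For a stable subordinator the set below is nonempty almost surely; on the exceptional
  null set the value is the unspecified real number \<open>Inf {}\<close>.
\<close>

definition inverse_process :: "(real \<Rightarrow> 'a \<Rightarrow> real) \<Rightarrow> real \<Rightarrow> 'a \<Rightarrow> real" where
  "inverse_process D t \<omega> = Inf {r. 0 \<le> r \<and> D r \<omega> > t}"

definition gamma_density :: "real \<Rightarrow> real \<Rightarrow> real \<Rightarrow> real" where
  "gamma_density b a x =
     (if x > 0 then b powr a / Gamma a * x powr (a - 1) * exp (- b * x) else 0)"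

text \<open>
  \<open>g\<close> is a version of the density of the \<open>\<alpha>\<close>-stable subordinator at time \<open>t\<close>, i.e. of the
  law on \<open>(0, \<infinity>)\<close> with Laplace transform \<open>exp (- t u\<^sup>\<alpha>)\<close>. The Bochner integral of a
  non-integrable function is 0, so the last clause includes integrability.
\<close>

definition stable_density :: "real \<Rightarrow> real \<Rightarrow> (real \<Rightarrow> real) \<Rightarrow> bool" where
  "stable_density \<alpha> t g \<longleftrightarrow>
     g \<in> borel_measurable borel \<and> (\<forall>x. 0 \<le> g x) \<and> (\<forall>x\<le>0. g x = 0) \<and>
     (\<forall>u\<ge>0. (\<integral>x. exp (- u * x) * g x \<partial>lborel) = exp (- t * u powr \<alpha>))"

context prob_space
begin

definition levy_process :: "(real \<Rightarrow> 'a \<Rightarrow> real) \<Rightarrow> bool" where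
  "levy_process X \<longleftrightarrow>
     (\<forall>t\<ge>0. random_variable borel (X t)) \<and>
     (\<forall>\<omega>\<in>space M. X 0 \<omega> = 0) \<and>
     (\<forall>(n::nat) \<tau>. 0 \<le> \<tau> 0 \<and> (\<forall>i<n. \<tau> i \<le> \<tau> (Suc i)) \<longrightarrow>
        indep_vars (\<lambda>_. borel) (\<lambda>i \<omega>. X (\<tau> (Suc i)) \<omega> - X (\<tau> i) \<omega>) {..<n}) \<and>
     (\<forall>s\<ge>0. \<forall>h\<ge>0. distr M borel (\<lambda>\<omega>. X (s + h) \<omega> - X s \<omega>) = distr M borel (X h)) \<and>
     (\<forall>\<omega>\<in>space M. cadlag (\<lambda>t. X t \<omega>))"

definition subordinator :: "(real \<Rightarrow> 'a \<Rightarrow> real) \<Rightarrow> bool" where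
  "subordinator X \<longleftrightarrow>
     levy_process X \<and> (\<forall>\<omega>\<in>space M. mono_on {0..} (\<lambda>t. X t \<omega>))"

definition gamma_subordinator :: "real \<Rightarrow> real \<Rightarrow> (real \<Rightarrow> 'a \<Rightarrow> real) \<Rightarrow> bool" where
  "gamma_subordinator lam\<^sub>1 \<beta>\<^sub>1 G \<longleftrightarrow>
     subordinator G \<and>
     (\<forall>t>0. distributed M lborel (G t) (\<lambda>x. ennreal (gamma_density lam\<^sub>1 (\<beta>\<^sub>1 * t) x)))"

definition stable_subordinator :: "real \<Rightarrow> (real \<Rightarrow> 'a \<Rightarrow> real) \<Rightarrow> bool" where
  "stable_subordinator \<beta> D \<longleftrightarrow>
     subordinator D \<and>
     (\<forall>r\<ge>0. \<forall>u\<ge>0. expectation (\<lambda>\<omega>. exp (- u * D r \<omega>)) = exp (- r * u powr \<beta>))"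

definition tempered_stable_subordinator ::
    "real \<Rightarrow> real \<Rightarrow> (real \<Rightarrow> 'a \<Rightarrow> real) \<Rightarrow> bool" where
  "tempered_stable_subordinator \<alpha> \<mu> S \<longleftrightarrow>
     subordinator S \<and>
     (\<forall>t>0. \<exists>g. stable_density \<alpha> t g \<and>
        distributed M lborel (S t) (\<lambda>x. ennreal (exp (- \<mu> * x + \<mu> powr \<alpha> * t) * g x)))"

definition poisson_process :: "real \<Rightarrow> (real \<Rightarrow> 'a \<Rightarrow> nat) \<Rightarrow> bool" where
  "poisson_process lam N \<longleftrightarrow>
     subordinator (\<lambda>t \<omega>. real (N t \<omega>)) \<and>
     (\<forall>t>0. distr M (count_space UNIV) (N t) = measure_pmf (poisson_pmf (lam * t)))"

text \<open>Independence of the generated \<open>\<sigma>\<close>-algebras, i.e. of the path-valued random variables.\<close>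

definition indep_processes :: "(real \<Rightarrow> 'a \<Rightarrow> real) \<Rightarrow> (real \<Rightarrow> 'a \<Rightarrow> real) \<Rightarrow> bool" where
  "indep_processes X Y \<longleftrightarrow>
     indep_var (\<Pi>\<^sub>M t\<in>{0..}. borel) (\<lambda>\<omega>. \<lambda>t\<in>{0..}. X t \<omega>)
               (\<Pi>\<^sub>M t\<in>{0..}. borel) (\<lambda>\<omega>. \<lambda>t\<in>{0..}. Y t \<omega>)"

definition tempered_mittag_leffler_levy_process ::
    "real \<Rightarrow> real \<Rightarrow> real \<Rightarrow> real \<Rightarrow> (real \<Rightarrow> 'a \<Rightarrow> real) \<Rightarrow> bool" where
  "tempered_mittag_leffler_levy_process \<alpha> \<beta>\<^sub>1 lam\<^sub>1 \<mu> L \<longleftrightarrow>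
     (\<exists>S G. tempered_stable_subordinator \<alpha> \<mu> S \<and> gamma_subordinator lam\<^sub>1 \<beta>\<^sub>1 G \<and>
        indep_processes S G \<and> L = time_change S G)"

definition fractional_poisson_process ::
    "real \<Rightarrow> real \<Rightarrow> (real \<Rightarrow> 'a \<Rightarrow> nat) \<Rightarrow> bool" where
  "fractional_poisson_process \<beta> lam F \<longleftrightarrow>
     (\<exists>N D. poisson_process lam N \<and> stable_subordinator \<beta> D \<and>
        indep_processes (\<lambda>t \<omega>. real (N t \<omega>)) (inverse_process D) \<and>
        F = time_change N (inverse_process D))"

text \<open>The tempered space-time fractional negative binomial process.\<close>

definition tstfnb_process ::
    "real \<Rightarrow> real \<Rightarrow> real \<Rightarrow> real \<Rightarrow> real \<Rightarrow> real \<Rightarrow> (real \<Rightarrow> 'a \<Rightarrow> nat) \<Rightarrow> bool" where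
  "tstfnb_process \<alpha> \<beta> \<beta>\<^sub>1 lam\<^sub>1 \<mu> lam Q \<longleftrightarrow>
     (\<exists>F L. fractional_poisson_process \<beta> lam F \<and>
        tempered_mittag_leffler_levy_process \<alpha> \<beta>\<^sub>1 lam\<^sub>1 \<mu> L \<and>
        indep_processes (\<lambda>t \<omega>. real (F t \<omega>)) L \<and> Q = time_change F L)"

end

end

(* If the process X has right continuous paths and is independent of the random time T, then
   E f(X_T) = E h(T) with h(y) = E f(X_y). Conditioning the Poisson process on the inverse stable
   time E_y gives E F_y = lam E[E_y] and E F_y^2 = lam^2 E[E_y^2] + lam E[E_y], so

     E F_y + (E F_y)^2 < E F_y^2   for y > 0

   because E_y is not almost surely constant (look at the Laplace transform of D_r for u -> 0 and
   for r -> 0). Conditioning on L_t > 0 and using Jensen's inequality for (E F_y)^2 at y = L_t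
   carries the strict inequality over to Q_t. The second moment must be shown to be finite, since
   otherwise the variance would be the integral of a non-integrable function, i.e. 0: the Chernoff
   bound P(D_n <= y) <= exp(u y - n u^beta) yields E F_y^2 <= C exp(u y), and
   E exp(u L_t) is finite as soon as mu^alpha - (mu - u)^alpha < lam_1. *)

theory Submission
  imports Defs
begin

section \<open>Evaluation of a right continuous process at an independent random time\<close>

text \<open>Evaluation \<open>(p, y) \<mapsto> p y\<close> is not jointly measurable on the product \<open>\<sigma>\<close>-algebra. The limit below
  is, and it agrees with \<open>p y\<close> wherever \<open>p\<close> is right continuous, as the times tend to \<open>y\<close> from
  strictly above.\<close>

definition path_eval :: "(real \<Rightarrow> real) \<Rightarrow> real \<Rightarrow> real" where
  "path_eval p y = lim (\<lambda>n. p (real (nat \<lfloor>real (Suc n) * y\<rfloor> + 1) / real (Suc n)))"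

text \<open>For fixed \<open>n\<close> the sampling time takes countably many values, and at each
  fixed value the expression is a coordinate of the product space. Measurability survives the
  countable gluing and the limit in \<open>n\<close>.\<close>

lemma path_eval_measurable:
  "(\<lambda>z. path_eval (fst z) (snd z)) \<in> borel_measurable ((\<Pi>\<^sub>M t\<in>{0..}. borel) \<Otimes>\<^sub>M borel)"
proof -
  have "(\<lambda>z. fst z (real (nat \<lfloor>real (Suc n) * snd z\<rfloor> + 1) / real (Suc n)))
      \<in> borel_measurable ((\<Pi>\<^sub>M t\<in>{0::real..}. (borel::real measure)) \<Otimes>\<^sub>M (borel::real measure))" for n
  proof (rule measurable_compose_countable[where f = "\<lambda>k z. fst z (real (k + 1) / real (Suc n))"
        and g = "\<lambda>z. nat \<lfloor>real (Suc n) * snd z\<rfloor>"])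
    fix k :: nat
    have "(\<lambda>p. p (real (k + 1) / real (Suc n)))
        \<in> borel_measurable (\<Pi>\<^sub>M t\<in>{0::real..}. (borel::real measure))"
      by (rule measurable_component_singleton) auto
    then show "(\<lambda>z. fst z (real (k + 1) / real (Suc n)))
      \<in> borel_measurable ((\<Pi>\<^sub>M t\<in>{0::real..}. (borel::real measure)) \<Otimes>\<^sub>M (borel::real measure))"
      by (rule measurable_compose[OF measurable_fst])
  next
    show "(\<lambda>z. nat \<lfloor>real (Suc n) * snd z\<rfloor>) \<in>
       (\<Pi>\<^sub>M t\<in>{0::real..}. (borel::real measure)) \<Otimes>\<^sub>M (borel::real measure) \<rightarrow>\<^sub>M count_space UNIV"
      by measurable
  qed
  then show ?thesis
    unfolding path_eval_def by (rule borel_measurable_lim_metric)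
qed

text \<open>The sampling times satisfy y < T n \<le> y + 1/(n+1), so they approach \<open>y\<close>
  strictly from the right. They are nonnegative, so restricting the path to \<open>{0..}\<close>
  leaves the sampled values unchanged.\<close>

lemma path_eval_eq:
  assumes y: "0 \<le> y" and rc: "(p \<longlongrightarrow> p y) (at_right y)"
  shows "path_eval (restrict p {0..}) y = p y"
proof -
  define T where "T n = real (nat \<lfloor>real (Suc n) * y\<rfloor> + 1) / real (Suc n)" for n
  have nn: "real (nat \<lfloor>real (Suc n) * y\<rfloor>) = of_int \<lfloor>real (Suc n) * y\<rfloor>" for n
    using y by simp
  have gt: "y < T n" for n
  proof -
    have "real (Suc n) * y < of_int \<lfloor>real (Suc n) * y\<rfloor> + 1" by linarith
    then show ?thesis unfolding T_def of_nat_add nn by (simp add: field_simps)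
  qed
  have le: "T n \<le> y + 1 / real (Suc n)" for n
  proof -
    have "T n \<le> (real (Suc n) * y + 1) / real (Suc n)"
      unfolding T_def of_nat_add nn by (intro divide_right_mono) auto
    also have "\<dots> = y + 1 / real (Suc n)"
      by (simp add: add_divide_distrib)
    finally show ?thesis .
  qed
  have "(\<lambda>n. y + 1 / real (Suc n)) \<longlonglongrightarrow> y + 0"
    by (intro tendsto_add tendsto_const LIMSEQ_Suc lim_1_over_n)
  moreover have "\<forall>\<^sub>F n in sequentially. y \<le> T n" "\<forall>\<^sub>F n in sequentially. T n \<le> y + 1 / real (Suc n)"
    using less_imp_le[OF gt] le by (auto simp del: of_nat_Suc)
  ultimately have "T \<longlonglongrightarrow> y"
    by (intro tendsto_sandwich[of "\<lambda>_. y" T sequentially "\<lambda>n. y + 1 / real (Suc n)"]) auto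
  then have "filterlim T (at_right y) sequentially"
    using gt less_imp_neq[OF gt, symmetric] by (auto simp: filterlim_at)
  then have "(\<lambda>n. p (T n)) \<longlonglongrightarrow> p y"
    by (rule filterlim_compose[OF rc])
  moreover have "restrict p {0..} (T n) = p (T n)" for n
    by (simp add: T_def)
  ultimately show ?thesis
    unfolding path_eval_def T_def[symmetric] by (simp add: limI)
qed

context prob_space
begin

text \<open>By independence the joint law of the two paths is a product measure, and Fubini
  integrates over the path of \<open>X\<close> with the time frozen. \<open>h\<close> lives on all
  reals so as to be Borel measurable, but is identified only on y \<ge> 0. Nonnegativity of the time
  is almost sure, as for an inverse subordinator, whose value is unspecified on a null set.\<close>

lemma indep_time_change_nn_integral:
  assumes ind: "indep_processes X Y" and s: "0 \<le> s"
    and rc: "\<And>\<omega> y. \<omega> \<in> space M \<Longrightarrow> 0 \<le> y \<Longrightarrow> ((\<lambda>t. X t \<omega>) \<longlongrightarrow> X y \<omega>) (at_right y)"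
    and pos: "AE \<omega> in M. 0 \<le> Y s \<omega>"
    and f: "f \<in> borel_measurable borel"
  obtains h :: "real \<Rightarrow> ennreal" where "h \<in> borel_measurable borel"
    and "\<And>y. 0 \<le> y \<Longrightarrow> h y = (\<integral>\<^sup>+\<omega>. f (X y \<omega>) \<partial>M)"
    and "(\<integral>\<^sup>+\<omega>. f (X (Y s \<omega>) \<omega>) \<partial>M) = (\<integral>\<^sup>+\<omega>. h (Y s \<omega>) \<partial>M)"
proof -
  let ?P = "\<Pi>\<^sub>M t\<in>{0::real..}. (borel::real measure)"
  define X' where "X' = (\<lambda>\<omega>. \<lambda>t\<in>{0..}. X t \<omega>)"
  define Y' where "Y' = (\<lambda>\<omega>. \<lambda>t\<in>{0..}. Y t \<omega>)"
  have iv: "indep_var ?P X' ?P Y'"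
    using ind by (simp add: indep_processes_def X'_def Y'_def)
  have X'[measurable]: "X' \<in> M \<rightarrow>\<^sub>M ?P" and Y'[measurable]: "Y' \<in> M \<rightarrow>\<^sub>M ?P"
    using iv by (simp_all add: indep_var_distribution_eq)
  have c[measurable]: "(\<lambda>q. q s) \<in> borel_measurable ?P"
    using s by (intro measurable_component_singleton) auto
  have Y's: "Y' \<omega> s = Y s \<omega>" for \<omega>
    using s by (simp add: Y'_def)
  have ev: "path_eval (X' \<omega>) y = X y \<omega>" if "\<omega> \<in> space M" "0 \<le> y" for \<omega> y
    unfolding X'_def by (rule path_eval_eq) (use that rc in auto)
  have \<phi>[measurable]: "(\<lambda>z. f (path_eval (fst z) (snd z))) \<in> borel_measurable (?P \<Otimes>\<^sub>M borel)"
    by (rule measurable_compose[OF path_eval_measurable f])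
  have \<psi>: "(\<lambda>z. f (path_eval (fst z) (snd z s))) \<in> borel_measurable (?P \<Otimes>\<^sub>M ?P)"
  proof -
    have "(\<lambda>z. (fst z, snd z s)) \<in> ?P \<Otimes>\<^sub>M ?P \<rightarrow>\<^sub>M ?P \<Otimes>\<^sub>M borel" by measurable
    from measurable_compose[OF this \<phi>] show ?thesis by simp
  qed
  interpret PX: prob_space "distr M ?P X'" by (rule prob_space_distr) measurable
  interpret PY: prob_space "distr M ?P Y'" by (rule prob_space_distr) measurable
  interpret PP: pair_sigma_finite "distr M ?P X'" "distr M ?P Y'" ..
  define h where "h y = (\<integral>\<^sup>+p. f (path_eval p y) \<partial>distr M ?P X')" for y
  have hm: "h \<in> borel_measurable borel"
  proof -
    have "(\<lambda>z. f (path_eval (snd z) (fst z))) \<in> borel_measurable (borel \<Otimes>\<^sub>M distr M ?P X')"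
      using measurable_compose[OF measurable_pair_swap' \<phi>]
      by (simp add: split_beta' cong: measurable_cong_sets sets_pair_measure_cong)
    from PX.borel_measurable_nn_integral_fst[OF this]
    show ?thesis unfolding h_def by simp
  qed
  have m1: "(\<lambda>p. f (path_eval p y)) \<in> borel_measurable ?P" for y
  proof -
    have "(\<lambda>p. (p, y)) \<in> ?P \<rightarrow>\<^sub>M ?P \<Otimes>\<^sub>M borel" by simp
    from measurable_compose[OF this \<phi>] show ?thesis by simp
  qed
  have hX: "h y = (\<integral>\<^sup>+\<omega>. f (X y \<omega>) \<partial>M)" if "0 \<le> y" for y
    unfolding h_def using that m1
    by (subst nn_integral_distr) (auto intro!: nn_integral_cong simp: ev)
  \<comment> \<open>Off the null set of negative times the value is given by
    \<open>path_eval\<close>, a jointly measurable function of the pair of paths, so the integral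
    can be moved to their joint law.\<close>
  have "(\<integral>\<^sup>+\<omega>. f (X (Y s \<omega>) \<omega>) \<partial>M) = (\<integral>\<^sup>+\<omega>. f (path_eval (X' \<omega>) (Y' \<omega> s)) \<partial>M)"
    using pos by (intro nn_integral_cong_AE) (auto simp: ev Y's)
  also have "\<dots> = (\<integral>\<^sup>+z. f (path_eval (fst z) (snd z s)) \<partial>distr M (?P \<Otimes>\<^sub>M ?P) (\<lambda>\<omega>. (X' \<omega>, Y' \<omega>)))"
    using \<psi> by (subst nn_integral_distr) auto
  also have "\<dots> = (\<integral>\<^sup>+z. f (path_eval (fst z) (snd z s)) \<partial>(distr M ?P X' \<Otimes>\<^sub>M distr M ?P Y'))"
    using iv by (simp add: indep_var_distribution_eq)
  also have "\<dots> = (\<integral>\<^sup>+q. h (q s) \<partial>distr M ?P Y')"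
    unfolding h_def using \<psi>
    by (subst PP.nn_integral_snd[symmetric])
      (simp_all cong: measurable_cong_sets sets_pair_measure_cong)
  also have "\<dots> = (\<integral>\<^sup>+\<omega>. h (Y s \<omega>) \<partial>M)"
    using measurable_compose[OF c hm] by (subst nn_integral_distr) (auto simp: Y's)
  finally show thesis using that hm hX by blast
qed

text \<open>\<open>M\<close> need not be complete, so the identity with \<open>path_eval\<close>
  must hold at every sample point; hence the time is nonnegative everywhere and not only almost
  surely.\<close>

lemma indep_time_change_measurable:
  assumes ind: "indep_processes X Y" and s: "0 \<le> s"
    and rc: "\<And>\<omega> y. \<omega> \<in> space M \<Longrightarrow> 0 \<le> y \<Longrightarrow> ((\<lambda>t. X t \<omega>) \<longlongrightarrow> X y \<omega>) (at_right y)"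
    and pos: "\<And>\<omega>. \<omega> \<in> space M \<Longrightarrow> 0 \<le> Y s \<omega>"
  shows "(\<lambda>\<omega>. X (Y s \<omega>) \<omega>) \<in> borel_measurable M"
proof -
  let ?P = "\<Pi>\<^sub>M t\<in>{0::real..}. (borel::real measure)"
  have X': "(\<lambda>\<omega>. \<lambda>t\<in>{0..}. X t \<omega>) \<in> M \<rightarrow>\<^sub>M ?P" and Y': "(\<lambda>\<omega>. \<lambda>t\<in>{0..}. Y t \<omega>) \<in> M \<rightarrow>\<^sub>M ?P"
    using ind by (simp_all add: indep_processes_def indep_var_distribution_eq)
  have "(\<lambda>\<omega>. (\<lambda>t\<in>{0..}. Y t \<omega>) s) \<in> borel_measurable M"
    by (rule measurable_compose[OF Y' measurable_component_singleton]) (use s in auto)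
  then have "Y s \<in> borel_measurable M" using s by simp
  with X' have "(\<lambda>\<omega>. (\<lambda>t\<in>{0..}. X t \<omega>, Y s \<omega>)) \<in> M \<rightarrow>\<^sub>M ?P \<Otimes>\<^sub>M borel" by simp
  from measurable_compose[OF this path_eval_measurable]
  have "(\<lambda>\<omega>. path_eval (\<lambda>t\<in>{0..}. X t \<omega>) (Y s \<omega>)) \<in> borel_measurable M" by simp
  then show ?thesis
    using rc pos by (subst measurable_cong[where g = "\<lambda>\<omega>. path_eval (\<lambda>t\<in>{0..}. X t \<omega>) (Y s \<omega>)"])
      (auto simp: path_eval_eq)
qed

lemma indep_processes_measurable:
  assumes ind: "indep_processes X Y" and s: "0 \<le> s"
  shows "X s \<in> borel_measurable M" "Y s \<in> borel_measurable M"
proof -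
  let ?P = "\<Pi>\<^sub>M t\<in>{0::real..}. (borel::real measure)"
  have X': "(\<lambda>\<omega>. \<lambda>t\<in>{0..}. X t \<omega>) \<in> M \<rightarrow>\<^sub>M ?P" and Y': "(\<lambda>\<omega>. \<lambda>t\<in>{0..}. Y t \<omega>) \<in> M \<rightarrow>\<^sub>M ?P"
    using ind by (simp_all add: indep_processes_def indep_var_distribution_eq)
  have "(\<lambda>\<omega>. (\<lambda>t\<in>{0..}. X t \<omega>) s) \<in> borel_measurable M"
    by (rule measurable_compose[OF X' measurable_component_singleton]) (use s in auto)
  then show "X s \<in> borel_measurable M" using s by simp
  have "(\<lambda>\<omega>. (\<lambda>t\<in>{0..}. Y t \<omega>) s) \<in> borel_measurable M"
    by (rule measurable_compose[OF Y' measurable_component_singleton]) (use s in auto)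
  then show "Y s \<in> borel_measurable M" using s by simp
qed

end

section \<open>First and second moments of the Poisson distribution\<close>

lemma nn_integral_poisson_pmf:
  assumes r: "0 < r"
  shows "(\<integral>\<^sup>+k. ennreal (real k) \<partial>poisson_pmf r) = ennreal r"
    and "(\<integral>\<^sup>+k. ennreal ((real k)\<^sup>2) \<partial>poisson_pmf r) = ennreal (r\<^sup>2 + r)"
proof -
  define w where "w k = r ^ k / fact k * exp (- r)" for k
  have w0: "w k \<ge> 0" for k using r by (simp add: w_def)
  have step: "w (Suc n) * real (Suc n) = r * w n" for n
    by (simp add: w_def field_simps del: of_nat_Suc)
  have s0: "w sums 1"
  proof -
    have "(\<lambda>k. r ^ k /\<^sub>R fact k * exp (- r)) sums (exp r * exp (- r))"
      by (intro sums_mult2 exp_converges)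
    moreover have "exp r * exp (- r) = 1" by (simp add: exp_add[symmetric])
    moreover have "r ^ k /\<^sub>R fact k * exp (- r) = w k" for k
      by (simp add: w_def divide_inverse)
    ultimately show ?thesis by simp
  qed
  have s1: "(\<lambda>k. w k * real k) sums r"
  proof -
    have "(\<lambda>n. w (Suc n) * real (Suc n)) sums (r * 1)"
      unfolding step by (intro sums_mult s0)
    from sums_Suc[OF this] show ?thesis by simp
  qed
  have s2: "(\<lambda>k. w k * (real k)\<^sup>2) sums (r\<^sup>2 + r)"
  proof -
    have eq: "w (Suc n) * (real (Suc n))\<^sup>2 = r * (w n * real n + w n)" for n
    proof -
      have "w (Suc n) * (real (Suc n))\<^sup>2 = w (Suc n) * real (Suc n) * real (Suc n)"
        by (simp only: power2_eq_square mult.assoc)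
      also have "\<dots> = r * (w n * real n + w n)"
        unfolding step by (simp add: algebra_simps)
      finally show ?thesis .
    qed
    have "(\<lambda>n. w (Suc n) * (real (Suc n))\<^sup>2) sums (r * (r + 1))"
      unfolding eq by (intro sums_mult sums_add s0 s1)
    from sums_Suc[OF this] show ?thesis by (simp add: power2_eq_square algebra_simps)
  qed
  have gen: "(\<integral>\<^sup>+k. ennreal (f k) \<partial>poisson_pmf r) = ennreal x"
    if "(\<lambda>k. w k * f k) sums x" "\<And>k. 0 \<le> f k" for f :: "nat \<Rightarrow> real" and x
  proof -
    have "(\<integral>\<^sup>+k. ennreal (f k) \<partial>poisson_pmf r) = (\<Sum>k. ennreal (pmf (poisson_pmf r) k) * ennreal (f k))"
      by (simp only: nn_integral_measure_pmf nn_integral_count_space_nat)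
    also have "\<dots> = (\<Sum>k. ennreal (w k * f k))"
      by (simp only: pmf_poisson[OF r] w_def[symmetric] ennreal_mult[OF w0 that(2)])
    also have "\<dots> = ennreal x"
      by (rule suminf_ennreal_eq) (use that w0 in auto)
    finally show ?thesis .
  qed
  show "(\<integral>\<^sup>+k. ennreal (real k) \<partial>poisson_pmf r) = ennreal r"
    by (rule gen[OF s1]) simp
  show "(\<integral>\<^sup>+k. ennreal ((real k)\<^sup>2) \<partial>poisson_pmf r) = ennreal (r\<^sup>2 + r)"
    by (rule gen[OF s2]) simp
qed

section \<open>Paths of the inverse process\<close>

lemma inverse_process_le:
  "0 \<le> r \<Longrightarrow> y < D r \<omega> \<Longrightarrow> inverse_process D y \<omega> \<le> r"
  unfolding inverse_process_def by (rule cInf_lower) (auto intro: bdd_belowI[of _ 0])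

lemma inverse_process_nonneg:
  "0 \<le> r \<Longrightarrow> y < D r \<omega> \<Longrightarrow> 0 \<le> inverse_process D y \<omega>"
  unfolding inverse_process_def by (rule cInf_greatest) auto

lemma inverse_process_less:
  assumes "0 \<le> r" "y < D r \<omega>" "inverse_process D y \<omega> < s"
  obtains r' where "0 \<le> r'" "r' < s" "y < D r' \<omega>"
proof -
  have "\<exists>x\<in>{r. 0 \<le> r \<and> y < D r \<omega>}. x < s"
    by (rule cInf_lessD) (use assms in \<open>auto simp: inverse_process_def\<close>)
  then show ?thesis using that by blast
qed

text \<open>Right continuity also holds where the path of \<open>D\<close> stays below \<open>y\<close>: there the inverse is
  constantly \<open>Inf {}\<close> from \<open>y\<close> on.\<close>

lemma time_change_inverse_right_continuous:
  fixes p :: "real \<Rightarrow> real"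
  assumes p: "\<And>x. 0 \<le> x \<Longrightarrow> (p \<longlongrightarrow> p x) (at_right x)"
  shows "((\<lambda>y. p (inverse_process D y \<omega>)) \<longlongrightarrow> p (inverse_process D y \<omega>)) (at_right y)"
proof (cases "\<exists>r\<ge>0. y < D r \<omega>")
  case False
  have "\<forall>\<^sub>F z in at_right y. p (inverse_process D z \<omega>) = p (inverse_process D y \<omega>)"
    unfolding eventually_at_right_field
  proof (intro exI[of _ "y + 1"] conjI allI impI)
    fix z assume "y < z"
    with False have "{r. 0 \<le> r \<and> z < D r \<omega>} = {}" "{r. 0 \<le> r \<and> y < D r \<omega>} = {}"
      by force+
    then show "p (inverse_process D z \<omega>) = p (inverse_process D y \<omega>)"
      by (simp only: inverse_process_def)
  qed simp
  then show ?thesis by (rule tendsto_eventually)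
next
  case True
  then obtain r where r: "0 \<le> r" "y < D r \<omega>" by blast
  let ?e = "inverse_process D y \<omega>"
  have e: "0 \<le> ?e" using inverse_process_nonneg[of r y D \<omega>] r by simp
  show ?thesis
  proof (rule tendstoI)
    fix \<epsilon> :: real assume \<epsilon>: "0 < \<epsilon>"
    have "\<forall>\<^sub>F x in at_right ?e. dist (p x) (p ?e) < \<epsilon>"
      using tendstoD[OF p[OF e] \<epsilon>] .
    then obtain b where b: "b > ?e" "\<And>x. ?e < x \<Longrightarrow> x < b \<Longrightarrow> dist (p x) (p ?e) < \<epsilon>"
      unfolding eventually_at_right_field by blast
    \<comment> \<open>By the infimum property \<open>D\<close> already exceeds \<open>y\<close> at
      some time r' < b. For y < z < D r' the inverse at \<open>z\<close> lies between
      \<open>?e\<close> and r', where \<open>p\<close> is close to \<open>p ?e\<close>.\<close>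
    obtain r' where r': "0 \<le> r'" "r' < b" "y < D r' \<omega>"
      using inverse_process_less[of r y D \<omega> b] r b(1) by blast
    show "\<forall>\<^sub>F z in at_right y. dist (p (inverse_process D z \<omega>)) (p ?e) < \<epsilon>"
      unfolding eventually_at_right_field
    proof (intro exI[of _ "D r' \<omega>"] conjI allI impI)
      fix z assume z: "y < z" "z < D r' \<omega>"
      have "inverse_process D z \<omega> \<le> r'"
        using inverse_process_le[of r' z D \<omega>] r' z by simp
      moreover have "?e \<le> inverse_process D z \<omega>"
        unfolding inverse_process_def
        by (rule cInf_superset_mono) (use r' z in \<open>auto intro: bdd_belowI[of _ 0]\<close>)
      ultimately show "dist (p (inverse_process D z \<omega>)) (p ?e) < \<epsilon>"
        using b(2)[of "inverse_process D z \<omega>"] r'(2) \<epsilon> by (cases "inverse_process D z \<omega> = ?e") auto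
    qed (use r' in auto)
  qed
qed

section \<open>Moments of the Poisson process and of the inverse stable subordinator\<close>

context prob_space
begin

lemma subordinator_nonneg:
  assumes "subordinator X" "\<omega> \<in> space M" "0 \<le> t"
  shows "0 \<le> X t \<omega>"
proof -
  have "X 0 \<omega> = 0" "mono_on {0..} (\<lambda>t. X t \<omega>)"
    using assms(1,2) by (auto simp: subordinator_def levy_process_def)
  then show ?thesis using mono_onD[of "{0..}" "\<lambda>t. X t \<omega>" 0 t] assms(3) by simp
qed

lemma subordinator_right_continuous:
  "subordinator X \<Longrightarrow> \<omega> \<in> space M \<Longrightarrow> 0 \<le> t \<Longrightarrow> ((\<lambda>t. X t \<omega>) \<longlongrightarrow> X t \<omega>) (at_right t)"
  unfolding subordinator_def levy_process_def cadlag_def by blast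

lemma subordinator_measurable:
  "subordinator X \<Longrightarrow> 0 \<le> t \<Longrightarrow> X t \<in> borel_measurable M"
  unfolding subordinator_def levy_process_def by blast

lemma poisson_process_moments:
  assumes N: "poisson_process lam N" and lam: "0 < lam" and t: "0 \<le> t"
  shows "(\<integral>\<^sup>+\<omega>. ennreal (real (N t \<omega>)) \<partial>M) = ennreal (lam * t)"
    and "(\<integral>\<^sup>+\<omega>. ennreal ((real (N t \<omega>))\<^sup>2) \<partial>M) = ennreal ((lam * t)\<^sup>2 + lam * t)"
proof -
  have "(\<integral>\<^sup>+\<omega>. ennreal (real (N t \<omega>)) \<partial>M) = ennreal (lam * t) \<and>
    (\<integral>\<^sup>+\<omega>. ennreal ((real (N t \<omega>))\<^sup>2) \<partial>M) = ennreal ((lam * t)\<^sup>2 + lam * t)"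
  \<comment> \<open>\<open>poisson_process\<close> prescribes the law only for t > 0; at time 0 the
    moments come from the path starting at 0.\<close>
  proof (cases "t = 0")
    case True
    have "real (N t \<omega>) = 0" if "\<omega> \<in> space M" for \<omega>
      using N that True unfolding poisson_process_def subordinator_def levy_process_def by blast
    then show ?thesis by (simp add: True cong: nn_integral_cong)
  next
    case False
    with t have t: "0 < t" by simp
    have "(\<lambda>\<omega>. real (N t \<omega>)) \<in> borel_measurable M"
      using N t by (intro subordinator_measurable) (auto simp: poisson_process_def)
    \<comment> \<open>Measurability is known for the real-valued version of \<open>N\<close>; the
      floor carries it back to the naturals.\<close>
    then have "(\<lambda>\<omega>. nat \<lfloor>real (N t \<omega>)\<rfloor>) \<in> M \<rightarrow>\<^sub>M count_space UNIV" by measurable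
    then have Nm: "N t \<in> M \<rightarrow>\<^sub>M count_space UNIV" by simp
    have D: "distr M (count_space UNIV) (N t) = measure_pmf (poisson_pmf (lam * t))"
      using N t by (auto simp: poisson_process_def)
    have gen: "(\<integral>\<^sup>+\<omega>. f (N t \<omega>) \<partial>M) = (\<integral>\<^sup>+k. f k \<partial>poisson_pmf (lam * t))" for f :: "nat \<Rightarrow> ennreal"
      unfolding D[symmetric] using Nm by (subst nn_integral_distr) auto
    have "0 < lam * t" using lam t by simp
    from nn_integral_poisson_pmf[OF this] show ?thesis
      unfolding gen[of "\<lambda>k. ennreal (real k)"] gen[of "\<lambda>k. ennreal ((real k)\<^sup>2)"] by blast
  qed
  then show "(\<integral>\<^sup>+\<omega>. ennreal (real (N t \<omega>)) \<partial>M) = ennreal (lam * t)"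
    and "(\<integral>\<^sup>+\<omega>. ennreal ((real (N t \<omega>))\<^sup>2) \<partial>M) = ennreal ((lam * t)\<^sup>2 + lam * t)"
    by auto
qed

text \<open>Chernoff bound: the indicator of D r \<le> y is at most exp (u (y - D r)), whose
  expectation is known from the Laplace transform.\<close>

lemma stable_subordinator_tail:
  assumes D: "stable_subordinator \<beta> D" and r: "0 \<le> r" and u: "0 \<le> u"
  shows "emeasure M {\<omega>\<in>space M. D r \<omega> \<le> y} \<le> ennreal (exp (u * y) * exp (- r * u powr \<beta>))"
proof -
  have [measurable]: "D r \<in> borel_measurable M"
    using D r by (auto simp: stable_subordinator_def intro: subordinator_measurable)
  have E: "expectation (\<lambda>\<omega>. exp (- u * D r \<omega>)) = exp (- r * u powr \<beta>)"
    using D r u by (auto simp: stable_subordinator_def)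
  \<comment> \<open>A Bochner integral with a nonzero value cannot be the default 0 of a
    non-integrable function.\<close>
  have I: "integrable M (\<lambda>\<omega>. exp (- u * D r \<omega>))"
    using E not_integrable_integral_eq exp_not_eq_zero by metis
  have "emeasure M {\<omega>\<in>space M. D r \<omega> \<le> y} = (\<integral>\<^sup>+\<omega>. indicator {\<omega>\<in>space M. D r \<omega> \<le> y} \<omega> \<partial>M)"
    by (rule nn_integral_indicator[symmetric]) measurable
  also have "\<dots> \<le> (\<integral>\<^sup>+\<omega>. ennreal (exp (u * y) * exp (- u * D r \<omega>)) \<partial>M)"
  proof (rule nn_integral_mono)
    fix \<omega>
    have "1 \<le> exp (u * y) * exp (- u * D r \<omega>)" if "D r \<omega> \<le> y"
      using mult_left_mono[OF that u] by (simp add: exp_add[symmetric])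
    then show "indicator {\<omega>\<in>space M. D r \<omega> \<le> y} \<omega> \<le> ennreal (exp (u * y) * exp (- u * D r \<omega>))"
      by (auto simp: indicator_def ennreal_ge_1)
  qed
  also have "\<dots> = ennreal (exp (u * y) * exp (- r * u powr \<beta>))"
    using I E by (subst nn_integral_eq_integral) auto
  finally show ?thesis .
qed

lemma inverse_stable_tail_series:
  assumes D: "stable_subordinator \<beta> D" and u: "0 < u"
  defines "q \<equiv> exp (- (u powr \<beta>))"
  shows "(\<integral>\<^sup>+\<omega>. ennreal ((inverse_process D y \<omega>)\<^sup>2) \<partial>M) \<le> ennreal (2 / (1 - q)\<^sup>2 * exp (u * y))"
    and "AE \<omega> in M. \<exists>r\<ge>0. y < D r \<omega>"
proof -
  have [measurable]: "D (real n) \<in> borel_measurable M" for n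
    using D by (auto simp: stable_subordinator_def intro: subordinator_measurable)
  define W where
    "W \<omega> = (\<Sum>n. ennreal (2 * real (Suc n)) * indicator {\<omega>\<in>space M. D (real n) \<omega> \<le> y} \<omega>)" for \<omega>
  have [measurable]: "W \<in> borel_measurable M" unfolding W_def by measurable
  have q: "0 < q" "q < 1" using u by (auto simp: q_def)
  have "(\<integral>\<^sup>+\<omega>. W \<omega> \<partial>M) =
      (\<Sum>n. ennreal (2 * real (Suc n)) * emeasure M {\<omega>\<in>space M. D (real n) \<omega> \<le> y})"
    unfolding W_def by (subst nn_integral_suminf) (auto simp: nn_integral_cmult)
  also have "\<dots> \<le> (\<Sum>n. ennreal (2 * exp (u * y) * (real (Suc n) * q ^ n)))"
  proof (intro suminf_le summableI)
    fix n
    have "exp (- real n * u powr \<beta>) = q ^ n"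
      unfolding q_def exp_of_nat_mult[symmetric] by simp
    then have "emeasure M {\<omega>\<in>space M. D (real n) \<omega> \<le> y} \<le> ennreal (exp (u * y) * q ^ n)"
      using stable_subordinator_tail[OF D, of "real n" u y] u by simp
    then have "ennreal (2 * real (Suc n)) * emeasure M {\<omega>\<in>space M. D (real n) \<omega> \<le> y}
        \<le> ennreal (2 * real (Suc n)) * ennreal (exp (u * y) * q ^ n)"
      by (intro mult_left_mono) auto
    also have "\<dots> = ennreal (2 * exp (u * y) * (real (Suc n) * q ^ n))"
      using q by (subst ennreal_mult[symmetric]) (auto simp: mult_ac simp del: of_nat_Suc)
    finally show "ennreal (2 * real (Suc n)) * emeasure M {\<omega>\<in>space M. D (real n) \<omega> \<le> y}
        \<le> ennreal (2 * exp (u * y) * (real (Suc n) * q ^ n))" .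
  qed
  also have "\<dots> = ennreal (2 * exp (u * y) * (1 / (1 - q)\<^sup>2))"
    using q geometric_deriv_sums[of q] by (intro suminf_ennreal_eq sums_mult) auto
  finally have W: "(\<integral>\<^sup>+\<omega>. W \<omega> \<partial>M) \<le> ennreal (2 / (1 - q)\<^sup>2 * exp (u * y))"
    by (simp add: mult_ac)
  \<comment> \<open>The weights are chosen so that their first \<open>k\<close> terms add up to
    k(k+1), which is at least k^2.\<close>
  have W_ge: "ennreal ((real k)\<^sup>2) \<le> W \<omega>"
    if "\<omega> \<in> space M" and k: "\<And>n. n < k \<Longrightarrow> D (real n) \<omega> \<le> y" for k \<omega>
  proof -
    have "(\<Sum>n<k. 2 * real (Suc n)) = real k * (real k + 1)"
      by (induction k) (auto simp: algebra_simps)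
    then have "ennreal ((real k)\<^sup>2) \<le> ennreal (\<Sum>n<k. 2 * real (Suc n))"
      by (intro ennreal_leI) (simp add: power2_eq_square algebra_simps)
    also have "\<dots> = (\<Sum>n<k. ennreal (2 * real (Suc n)) * indicator {\<omega>\<in>space M. D (real n) \<omega> \<le> y} \<omega>)"
      using that by (subst sum_ennreal[symmetric]) (auto intro!: sum.cong)
    also have "\<dots> \<le> W \<omega>"
      unfolding W_def by (intro sum_le_suminf) auto
    finally show ?thesis .
  qed
  \<comment> \<open>On a path that never exceeds \<open>y\<close>, \<open>W\<close> is at least k^2
    for every k, hence infinite, and this has probability zero.\<close>
  have "(\<integral>\<^sup>+\<omega>. W \<omega> \<partial>M) \<noteq> \<infinity>" using W by (auto simp: top_unique)
  then have "AE \<omega> in M. W \<omega> \<noteq> \<infinity>" by (intro nn_integral_noteq_infinite) auto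
  then show ne: "AE \<omega> in M. \<exists>r\<ge>0. y < D r \<omega>"
  proof (rule AE_mp, intro AE_I2 impI)
    fix \<omega> assume \<omega>: "\<omega> \<in> space M" "W \<omega> \<noteq> \<infinity>"
    show "\<exists>r\<ge>0. y < D r \<omega>"
    proof (rule ccontr)
      assume "\<not> (\<exists>r\<ge>0. y < D r \<omega>)"
      then have le: "ennreal ((real k)\<^sup>2) \<le> W \<omega>" for k
        using W_ge[OF \<omega>(1), of k] by (auto simp: not_less)
      obtain w where w: "W \<omega> = ennreal w" "0 \<le> w" using \<omega>(2) by (cases "W \<omega>") auto
      obtain k where k: "w + 1 < real k" using reals_Archimedean2 by blast
      then have "w < (real k)\<^sup>2"
        using w(2) self_le_power[of "real k" 2] by linarith
      with le[of k] w show False by simp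
    qed
  qed
  have "(\<integral>\<^sup>+\<omega>. ennreal ((inverse_process D y \<omega>)\<^sup>2) \<partial>M) \<le> (\<integral>\<^sup>+\<omega>. W \<omega> \<partial>M)"
  proof (rule nn_integral_mono_AE, rule AE_mp[OF ne], intro AE_I2 impI)
    fix \<omega> assume \<omega>: "\<omega> \<in> space M" "\<exists>r\<ge>0. y < D r \<omega>"
    let ?e = "inverse_process D y \<omega>"
    have e: "0 \<le> ?e" using \<omega>(2) inverse_process_nonneg by metis
    \<comment> \<open>For a natural n, n < k means that n is strictly below the inverse, so
      \<open>D\<close> has not passed \<open>y\<close> at time n; and rounding up makes k^2 dominate
      the square of the inverse.\<close>
    define k where "k = nat \<lceil>?e\<rceil>"
    have "D (real n) \<omega> \<le> y" if "n < k" for n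
    proof (rule ccontr)
      assume "\<not> D (real n) \<omega> \<le> y"
      then have "?e \<le> real n" by (intro inverse_process_le) auto
      with that show False unfolding k_def by linarith
    qed
    then have "ennreal ((real k)\<^sup>2) \<le> W \<omega>" by (rule W_ge[OF \<omega>(1)])
    moreover have "?e\<^sup>2 \<le> (real k)\<^sup>2"
      using e by (intro power_mono) (auto simp: k_def)
    ultimately show "ennreal (?e\<^sup>2) \<le> W \<omega>"
      using ennreal_leI order_trans by blast
  qed
  with W show "(\<integral>\<^sup>+\<omega>. ennreal ((inverse_process D y \<omega>)\<^sup>2) \<partial>M) \<le> ennreal (2 / (1 - q)\<^sup>2 * exp (u * y))"
    by (rule order_trans[rotated])
qed

text \<open>If the inverse equals c > 0, then D at time c/2 is almost surely bounded by
  \<open>y\<close>, against the behaviour of its Laplace transform as u tends to 0. If c = 0, then D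
  r \<ge> y almost surely for every r > 0, against the behaviour as r tends to 0.\<close>

lemma inverse_stable_not_constant:
  assumes D: "stable_subordinator \<beta> D" and \<beta>: "0 < \<beta>" "\<beta> < 1" and y: "0 < y"
  shows "\<not> (AE \<omega> in M. inverse_process D y \<omega> = c)"
proof
  assume c: "AE \<omega> in M. inverse_process D y \<omega> = c"
  have ne: "AE \<omega> in M. \<exists>r\<ge>0. y < D r \<omega>"
    by (rule inverse_stable_tail_series(2)[OF D, of 1]) simp
  have sub: "subordinator D" using D by (simp add: stable_subordinator_def)
  have [measurable]: "D r \<in> borel_measurable M" if "0 \<le> r" for r
    using sub that by (rule subordinator_measurable)
  have L: "expectation (\<lambda>\<omega>. exp (- u * D r \<omega>)) = exp (- r * u powr \<beta>)" if "0 \<le> u" "0 \<le> r" for u r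
    using D that by (auto simp: stable_subordinator_def)
  have I: "integrable M (\<lambda>\<omega>. exp (- u * D r \<omega>))" if "0 \<le> u" "0 \<le> r" for u r
    using L[OF that] not_integrable_integral_eq exp_not_eq_zero by metis
  have "AE \<omega> in M. 0 \<le> c"
    using c ne by eventually_elim (use inverse_process_nonneg in metis)
  then have c0: "0 \<le> c" by simp
  show False
  proof (cases "c = 0")
    case False
    define r where "r = c / 2"
    have r: "0 < r" "r < c" using False c0 by (auto simp: r_def)
    \<comment> \<open>If D r exceeded \<open>y\<close>, the inverse would be at most r, which is
      less than c.\<close>
    have le: "AE \<omega> in M. D r \<omega> \<le> y"
      using c by eventually_elim
        (use r inverse_process_le[of r y D] in \<open>force simp: not_le[symmetric]\<close>)
    have *: "r * u powr \<beta> \<le> u * y" if "0 < u" for u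
    proof -
      have "(\<integral>\<omega>. exp (- u * y) \<partial>M) \<le> expectation (\<lambda>\<omega>. exp (- u * D r \<omega>))"
        using le that r by (intro integral_mono_AE I) auto
      then show ?thesis using L[of u r] that r by (simp add: prob_space)
    qed
    \<comment> \<open>Division by u^\<beta> leaves a fixed positive lower bound for a quantity that
      tends to 0 with u, because \<beta> < 1.\<close>
    have **: "r / y \<le> u powr (1 - \<beta>)" if "0 < u" for u
    proof -
      have "u = u powr \<beta> * u powr (1 - \<beta>)"
        using that by (simp add: powr_add[symmetric])
      with *[OF that] have "u powr \<beta> * r \<le> u powr \<beta> * (u powr (1 - \<beta>) * y)"
        by (simp add: mult_ac)
      then have "r \<le> u powr (1 - \<beta>) * y" using that by simp
      then show ?thesis using y by (simp add: field_simps)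
    qed
    \<comment> \<open>This value makes u^(1-\<beta>) equal to r/(2y), half of the lower bound just
      derived.\<close>
    define u where "u = (r / (2 * y)) powr (1 / (1 - \<beta>))"
    have "0 < u" using r y by (simp add: u_def)
    moreover have "u powr (1 - \<beta>) = r / (2 * y)"
      using r y \<beta> by (simp add: u_def powr_powr)
    ultimately show False using **[of u] r y by (simp add: field_simps)
  next
    case True
    have *: "exp (- r) \<le> exp (- y)" if r: "0 < r" for r
    proof -
      \<comment> \<open>An inverse equal to 0 means that \<open>D\<close> exceeds \<open>y\<close>
        at arbitrarily small times, and monotone paths carry this to time r.\<close>
      have "AE \<omega> in M. y \<le> D r \<omega>"
        using c ne AE_space
      proof eventually_elim
        case (elim \<omega>)
        then obtain r' where r': "0 \<le> r'" "r' < r" "y < D r' \<omega>"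
          using inverse_process_less[of _ y D \<omega> r] True r by metis
        have "D r' \<omega> \<le> D r \<omega>"
          using sub elim r' unfolding subordinator_def by (auto intro: mono_onD)
        with r' show ?case by simp
      qed
      then have "expectation (\<lambda>\<omega>. exp (- 1 * D r \<omega>)) \<le> (\<integral>\<omega>. exp (- y) \<partial>M)"
        using r by (intro integral_mono_AE I) auto
      then show ?thesis using L[of 1 r] r by (simp add: prob_space)
    qed
    show False using *[of "y / 2"] y by simp
  qed
qed

section \<open>The fractional Poisson process\<close>

lemma fractional_poisson_process_right_continuous:
  assumes F: "fractional_poisson_process \<beta> lam F" and \<omega>: "\<omega> \<in> space M"
  shows "((\<lambda>t. real (F t \<omega>)) \<longlongrightarrow> real (F y \<omega>)) (at_right y)"
proof -
  obtain N D where N: "poisson_process lam N" and F: "F = time_change N (inverse_process D)"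
    using F unfolding fractional_poisson_process_def by blast
  have "subordinator (\<lambda>t \<omega>. real (N t \<omega>))"
    using N by (simp add: poisson_process_def)
  from time_change_inverse_right_continuous[OF subordinator_right_continuous[OF this \<omega>]]
  show ?thesis unfolding F time_change_def .
qed

text \<open>Conditionally on the inverse stable time E_y, F_y is Poisson with mean lam E_y. Hence E
  F_y^2 - E F_y - (E F_y)^2 = lam^2 Var E_y, which is positive since E_y is not constant. The growth
  rate \<open>u\<close> is arbitrary so that it can later be matched with a small exponential moment
  of the random time.\<close>

lemma fractional_poisson_process_moments:
  assumes F: "fractional_poisson_process \<beta> lam F"
    and \<beta>: "0 < \<beta>" "\<beta> < 1" and lam: "0 < lam"
  shows "0 < u \<Longrightarrow> \<exists>C\<ge>0. \<forall>y\<ge>0.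
      (\<integral>\<^sup>+\<omega>. ennreal ((real (F y \<omega>))\<^sup>2) \<partial>M) \<le> ennreal (C * exp (u * y))"
    and "0 < y \<Longrightarrow> \<exists>a\<ge>0. \<exists>b\<ge>0. (\<integral>\<^sup>+\<omega>. ennreal (real (F y \<omega>)) \<partial>M) = ennreal a \<and>
      (\<integral>\<^sup>+\<omega>. ennreal ((real (F y \<omega>))\<^sup>2) \<partial>M) = ennreal b \<and> a + a\<^sup>2 < b"
proof -
  obtain N D where N: "poisson_process lam N" and D: "stable_subordinator \<beta> D"
    and ind: "indep_processes (\<lambda>t \<omega>. real (N t \<omega>)) (inverse_process D)"
    and F: "F = time_change N (inverse_process D)"
    using F unfolding fractional_poisson_process_def by blast
  let ?E = "inverse_process D"
  have subN: "subordinator (\<lambda>t \<omega>. real (N t \<omega>))"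
    using N by (simp add: poisson_process_def)
  have E_nonneg: "AE \<omega> in M. 0 \<le> ?E y \<omega>" for y
  proof -
    have "AE \<omega> in M. \<exists>r\<ge>0. y < D r \<omega>"
      by (rule inverse_stable_tail_series(2)[OF D, of 1]) simp
    then show ?thesis
      by eventually_elim (auto intro: inverse_process_nonneg)
  qed
  have Em: "?E y \<in> borel_measurable M" if "0 \<le> y" for y
    by (rule indep_processes_measurable(2)[OF ind that])
  have A: "(\<integral>\<^sup>+\<omega>. ennreal (real (F y \<omega>)) \<partial>M) = (\<integral>\<^sup>+\<omega>. ennreal (lam * ?E y \<omega>) \<partial>M)" if y: "0 \<le> y" for y
  proof -
    have f: "(\<lambda>x::real. ennreal x) \<in> borel_measurable borel" by measurable
    obtain h where "h \<in> borel_measurable borel"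
      and h: "\<And>z. 0 \<le> z \<Longrightarrow> h z = (\<integral>\<^sup>+\<omega>. ennreal (real (N z \<omega>)) \<partial>M)"
      and eq: "(\<integral>\<^sup>+\<omega>. ennreal (real (N (?E y \<omega>) \<omega>)) \<partial>M) = (\<integral>\<^sup>+\<omega>. h (?E y \<omega>) \<partial>M)"
      by (rule indep_time_change_nn_integral[OF ind y subordinator_right_continuous[OF subN] E_nonneg f]) (assumption | rule that)+
    have "(\<integral>\<^sup>+\<omega>. h (?E y \<omega>) \<partial>M) = (\<integral>\<^sup>+\<omega>. ennreal (lam * ?E y \<omega>) \<partial>M)"
      by (rule nn_integral_cong_AE, rule AE_mp[OF E_nonneg[of y]])
        (simp add: h poisson_process_moments(1)[OF N lam])
    with eq show ?thesis by (simp add: F time_change_def)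
  qed
  have B: "(\<integral>\<^sup>+\<omega>. ennreal ((real (F y \<omega>))\<^sup>2) \<partial>M)
      = (\<integral>\<^sup>+\<omega>. ennreal ((lam * ?E y \<omega>)\<^sup>2 + lam * ?E y \<omega>) \<partial>M)" if y: "0 \<le> y" for y
  proof -
    have f: "(\<lambda>x::real. ennreal (x\<^sup>2)) \<in> borel_measurable borel" by measurable
    obtain h where "h \<in> borel_measurable borel"
      and h: "\<And>z. 0 \<le> z \<Longrightarrow> h z = (\<integral>\<^sup>+\<omega>. ennreal ((real (N z \<omega>))\<^sup>2) \<partial>M)"
      and eq: "(\<integral>\<^sup>+\<omega>. ennreal ((real (N (?E y \<omega>) \<omega>))\<^sup>2) \<partial>M) = (\<integral>\<^sup>+\<omega>. h (?E y \<omega>) \<partial>M)"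
      by (rule indep_time_change_nn_integral[OF ind y subordinator_right_continuous[OF subN] E_nonneg f]) (assumption | rule that)+
    have "(\<integral>\<^sup>+\<omega>. h (?E y \<omega>) \<partial>M) = (\<integral>\<^sup>+\<omega>. ennreal ((lam * ?E y \<omega>)\<^sup>2 + lam * ?E y \<omega>) \<partial>M)"
      by (rule nn_integral_cong_AE, rule AE_mp[OF E_nonneg[of y]])
        (simp add: h poisson_process_moments(2)[OF N lam] del: ennreal_plus)
    with eq show ?thesis by (simp add: F time_change_def)
  qed
  {
    assume u: "0 < u"
    define K where "K = 2 / (1 - exp (- (u powr \<beta>)))\<^sup>2"
    have K: "0 \<le> K" by (simp add: K_def)
    show "\<exists>C\<ge>0. \<forall>y\<ge>0. (\<integral>\<^sup>+\<omega>. ennreal ((real (F y \<omega>))\<^sup>2) \<partial>M) \<le> ennreal (C * exp (u * y))"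
    proof (intro exI[of _ "(lam\<^sup>2 + lam) * K + lam"] conjI allI impI)
      fix y :: real assume y: "0 \<le> y"
      note [measurable] = Em[OF y]
      \<comment> \<open>Since e \<le> e^2 + 1, only the second moment of the inverse has to be
        bounded.\<close>
      have pw: "(lam * e)\<^sup>2 + lam * e \<le> (lam\<^sup>2 + lam) * e\<^sup>2 + lam" for e :: real
      proof -
        have "0 \<le> (e - 1/2)\<^sup>2 + 3/4" by simp
        then have "lam * e \<le> lam * (e\<^sup>2 + 1)"
          using lam by (intro mult_left_mono) (auto simp: power2_eq_square algebra_simps)
        then show ?thesis by (simp add: power_mult_distrib algebra_simps)
      qed
      have "(\<integral>\<^sup>+\<omega>. ennreal ((real (F y \<omega>))\<^sup>2) \<partial>M)
          \<le> (\<integral>\<^sup>+\<omega>. ennreal (lam\<^sup>2 + lam) * ennreal ((?E y \<omega>)\<^sup>2) + ennreal lam \<partial>M)"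
        unfolding B[OF y] using lam
        by (intro nn_integral_mono)
          (simp add: ennreal_mult[symmetric] ennreal_plus[symmetric] ennreal_leI pw del: ennreal_plus)
      also have "\<dots> = ennreal (lam\<^sup>2 + lam) * (\<integral>\<^sup>+\<omega>. ennreal ((?E y \<omega>)\<^sup>2) \<partial>M) + ennreal lam"
        by (simp add: nn_integral_add nn_integral_cmult emeasure_space_1)
      also have "\<dots> \<le> ennreal (lam\<^sup>2 + lam) * ennreal (K * exp (u * y)) + ennreal lam"
        unfolding K_def
        by (intro add_mono mult_left_mono inverse_stable_tail_series(1)[OF D u]) auto
      also have "\<dots> = ennreal ((lam\<^sup>2 + lam) * (K * exp (u * y)) + lam)"
        using lam K by (simp add: ennreal_mult[symmetric] ennreal_plus[symmetric] del: ennreal_plus)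
      also have "\<dots> \<le> ennreal (((lam\<^sup>2 + lam) * K + lam) * exp (u * y))"
      proof (rule ennreal_leI)
        \<comment> \<open>The additive constant is absorbed into the exponential, which is at least
          1 for y \<ge> 0.\<close>
        have "lam * 1 \<le> lam * exp (u * y)"
          using lam u y by (intro mult_left_mono) auto
        then show "(lam\<^sup>2 + lam) * (K * exp (u * y)) + lam \<le> ((lam\<^sup>2 + lam) * K + lam) * exp (u * y)"
          by (simp add: algebra_simps)
      qed
      finally show "(\<integral>\<^sup>+\<omega>. ennreal ((real (F y \<omega>))\<^sup>2) \<partial>M)
        \<le> ennreal (((lam\<^sup>2 + lam) * K + lam) * exp (u * y))" .
    qed (use lam K in simp)
  }
  {
    assume y: "0 < y"
    note Em' [measurable] = Em[OF less_imp_le[OF y]]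
    have "(\<integral>\<^sup>+\<omega>. ennreal ((?E y \<omega>)\<^sup>2) \<partial>M) < \<infinity>"
      using inverse_stable_tail_series(1)[OF D, of 1 y]
      by (auto intro: le_less_trans)
    then have I2: "integrable M (\<lambda>\<omega>. (?E y \<omega>)\<^sup>2)"
      by (intro integrableI_nonneg) auto
    have I1: "integrable M (?E y)"
      by (rule square_integrable_imp_integrable[OF Em' I2])
    define m1 m2 where "m1 = expectation (?E y)" and "m2 = expectation (\<lambda>\<omega>. (?E y \<omega>)\<^sup>2)"
    have var: "variance (?E y) = m2 - m1\<^sup>2"
      unfolding m1_def m2_def by (rule variance_eq[OF I1 I2])
    have IV: "integrable M (\<lambda>\<omega>. (?E y \<omega> - m1)\<^sup>2)"
      unfolding power2_diff using I1 I2 by auto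
    have "variance (?E y) \<noteq> 0"
    proof
      assume "variance (?E y) = 0"
      then have "AE \<omega> in M. (?E y \<omega> - m1)\<^sup>2 = 0"
        unfolding m1_def[symmetric] using IV by (subst (asm) integral_nonneg_eq_0_iff_AE) auto
      then have "AE \<omega> in M. ?E y \<omega> = m1" by simp
      with inverse_stable_not_constant[OF D \<beta> y] show False by blast
    qed
    then have v: "m1\<^sup>2 < m2" using variance_positive[of "?E y"] var by simp
    have m: "0 \<le> m1" "0 \<le> m2"
      unfolding m1_def m2_def using E_nonneg[of y] by (auto intro: integral_nonneg_AE)
    show "\<exists>a\<ge>0. \<exists>b\<ge>0. (\<integral>\<^sup>+\<omega>. ennreal (real (F y \<omega>)) \<partial>M) = ennreal a \<and>
      (\<integral>\<^sup>+\<omega>. ennreal ((real (F y \<omega>))\<^sup>2) \<partial>M) = ennreal b \<and> a + a\<^sup>2 < b"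
    proof (intro exI conjI)
      show "(\<integral>\<^sup>+\<omega>. ennreal (real (F y \<omega>)) \<partial>M) = ennreal (lam * m1)"
        unfolding A[OF less_imp_le[OF y]] m1_def using I1 E_nonneg[of y] lam
        by (subst nn_integral_eq_integral) auto
      have "(\<integral>\<^sup>+\<omega>. ennreal ((lam * ?E y \<omega>)\<^sup>2 + lam * ?E y \<omega>) \<partial>M)
          = ennreal (\<integral>\<omega>. (lam * ?E y \<omega>)\<^sup>2 + lam * ?E y \<omega> \<partial>M)"
        using I1 I2 E_nonneg[of y] lam
        by (intro nn_integral_eq_integral) (auto simp: power_mult_distrib)
      also have "(\<integral>\<omega>. (lam * ?E y \<omega>)\<^sup>2 + lam * ?E y \<omega> \<partial>M) = lam\<^sup>2 * m2 + lam * m1"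
        unfolding m1_def m2_def power_mult_distrib using I1 I2
        by (subst Bochner_Integration.integral_add) auto
      finally show "(\<integral>\<^sup>+\<omega>. ennreal ((real (F y \<omega>))\<^sup>2) \<partial>M) = ennreal (lam\<^sup>2 * m2 + lam * m1)"
        unfolding B[OF less_imp_le[OF y]] .
      show "lam * m1 + (lam * m1)\<^sup>2 < lam\<^sup>2 * m2 + lam * m1"
        using v lam by (simp add: power_mult_distrib)
    qed (use m lam in auto)
  }
qed

section \<open>Exponential moments of the tempered Mittag-Leffler process\<close>

text \<open>The factor exp (u x) lowers the tempering parameter from \<mu> to \<mu> - u \<ge> 0, so
  the moment is a Laplace transform of the stable density at \<mu> - u. Positivity holds because
  that density vanishes on x \<le> 0.\<close>

lemma tempered_stable_exp_moment:
  assumes S: "tempered_stable_subordinator \<alpha> \<mu> S" and t: "0 < t" and u: "u \<le> \<mu>"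
  shows "(\<integral>\<^sup>+\<omega>. ennreal (exp (u * S t \<omega>)) \<partial>M) = ennreal (exp ((\<mu> powr \<alpha> - (\<mu> - u) powr \<alpha>) * t))"
    and "AE \<omega> in M. 0 < S t \<omega>"
proof -
  obtain g where g: "stable_density \<alpha> t g"
    and d: "distributed M lborel (S t) (\<lambda>x. ennreal (exp (- \<mu> * x + \<mu> powr \<alpha> * t) * g x))"
    using S t unfolding tempered_stable_subordinator_def by blast
  have gm [measurable]: "g \<in> borel_measurable borel"
    and g0: "\<And>x. 0 \<le> g x" "\<And>x. x \<le> 0 \<Longrightarrow> g x = 0"
    and laplace: "\<And>v. 0 \<le> v \<Longrightarrow> (\<integral>x. exp (- v * x) * g x \<partial>lborel) = exp (- t * v powr \<alpha>)"
    using g unfolding stable_density_def by blast+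
  have gL: "(\<integral>x. exp (- (\<mu> - u) * x) * g x \<partial>lborel) = exp (- t * (\<mu> - u) powr \<alpha>)"
    using u by (intro laplace) simp
  have gI: "integrable lborel (\<lambda>x. exp (- (\<mu> - u) * x) * g x)"
    using gL not_integrable_integral_eq exp_not_eq_zero by metis
  have "(\<integral>\<^sup>+\<omega>. ennreal (exp (u * S t \<omega>)) \<partial>M) =
      (\<integral>\<^sup>+x. ennreal (exp (- \<mu> * x + \<mu> powr \<alpha> * t) * g x) * ennreal (exp (u * x)) \<partial>lborel)"
    by (rule distributed_nn_integral[OF d, symmetric]) measurable
  also have "\<dots> = (\<integral>\<^sup>+x. ennreal (exp (\<mu> powr \<alpha> * t) * (exp (- (\<mu> - u) * x) * g x)) \<partial>lborel)"
  proof (rule nn_integral_cong)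
    fix x :: real
    have "exp (- \<mu> * x + \<mu> powr \<alpha> * t) * exp (u * x) = exp (\<mu> powr \<alpha> * t) * exp (- (\<mu> - u) * x)"
      unfolding exp_add[symmetric] by (simp add: algebra_simps)
    then have "exp (- \<mu> * x + \<mu> powr \<alpha> * t) * g x * exp (u * x) =
        exp (\<mu> powr \<alpha> * t) * (exp (- (\<mu> - u) * x) * g x)"
      by (metis mult.assoc mult.commute)
    then show "ennreal (exp (- \<mu> * x + \<mu> powr \<alpha> * t) * g x) * ennreal (exp (u * x)) =
        ennreal (exp (\<mu> powr \<alpha> * t) * (exp (- (\<mu> - u) * x) * g x))"
      by (simp only: ennreal_mult''[symmetric] exp_ge_zero)
  qed
  also have "\<dots> = ennreal (exp (\<mu> powr \<alpha> * t) * exp (- t * (\<mu> - u) powr \<alpha>))"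
    using gI gL g0(1) by (subst nn_integral_eq_integral) auto
  also have "exp (\<mu> powr \<alpha> * t) * exp (- t * (\<mu> - u) powr \<alpha>) = exp ((\<mu> powr \<alpha> - (\<mu> - u) powr \<alpha>) * t)"
    by (simp add: exp_add[symmetric] algebra_simps)
  finally show "(\<integral>\<^sup>+\<omega>. ennreal (exp (u * S t \<omega>)) \<partial>M)
    = ennreal (exp ((\<mu> powr \<alpha> - (\<mu> - u) powr \<alpha>) * t))" .
  show "AE \<omega> in M. 0 < S t \<omega>"
  proof (subst distributed_AE2[OF d])
    have "0 < x" if "0 < ennreal (c * g x)" for c x
      using that g0(2)[of x] by (cases "x \<le> 0") auto
    then show "AE x in lborel. 0 < ennreal (exp (- \<mu> * x + \<mu> powr \<alpha> * t) * g x) \<longrightarrow> 0 < x"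
      by blast
  qed measurable
qed

end

text \<open>The kernel is the norm of the integrand of the complex Gamma integral at a real
  argument, which converges absolutely; passing from \<open>lebesgue\<close> to
  \<open>lborel\<close> does not change the value.\<close>

lemma nn_integral_gamma_kernel_finite:
  assumes a: "0 < a" and c: "0 < c"
  shows "(\<integral>\<^sup>+x. ennreal (indicator {0<..} x * (x powr (a - 1) * exp (- c * x))) \<partial>lborel) < \<infinity>"
proof -
  let ?f = "\<lambda>x. indicator {0<..} x *\<^sub>R (complex_of_real x powr (complex_of_real a - 1) / of_real (exp (c * x)))"
  have "integrable lebesgue ?f"
    using absolutely_integrable_Gamma_integral[of "complex_of_real a" c] a c
    by (simp add: set_integrable_def)
  then have "(\<integral>\<^sup>+x. ennreal (norm (?f x)) \<partial>lebesgue) < \<infinity>"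
    by (simp add: integrable_iff_bounded)
  also have "(\<integral>\<^sup>+x. ennreal (norm (?f x)) \<partial>lebesgue) =
      (\<integral>\<^sup>+x. ennreal (indicator {0<..} x * (x powr (a - 1) * exp (- c * x))) \<partial>lebesgue)"
  proof (intro nn_integral_cong arg_cong[where f = ennreal])
    fix x :: real
    have "norm (complex_of_real x powr (complex_of_real a - 1)) = x powr (a - 1)" if "0 < x"
      using that by (subst norm_powr_real_powr) auto
    then show "norm (?f x) = indicator {0<..} x * (x powr (a - 1) * exp (- c * x))"
      by (auto simp: indicator_def norm_divide exp_minus divide_inverse norm_mult norm_inverse)
  qed
  finally show ?thesis by (simp add: nn_integral_completion)
qed

context prob_space
begin

text \<open>The factor exp (\<theta> x) replaces the rate b in the gamma density by b - \<theta>,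
  which is still positive.\<close>

lemma gamma_subordinator_exp_moment:
  assumes G: "gamma_subordinator b a G" and pos: "0 < a" "0 < t" and \<theta>: "\<theta> < b"
  shows "(\<integral>\<^sup>+\<omega>. ennreal (exp (\<theta> * G t \<omega>)) \<partial>M) < \<infinity>"
    and "AE \<omega> in M. 0 < G t \<omega>"
proof -
  have d: "distributed M lborel (G t) (\<lambda>x. ennreal (gamma_density b (a * t) x))"
    using G pos unfolding gamma_subordinator_def by blast
  define k where "k = b powr (a * t) / Gamma (a * t)"
  have at: "0 < a * t" using pos by simp
  have k: "0 \<le> k" unfolding k_def using Gamma_real_pos[OF at] by simp
  have "(\<integral>\<^sup>+\<omega>. ennreal (exp (\<theta> * G t \<omega>)) \<partial>M) =
      (\<integral>\<^sup>+x. ennreal (gamma_density b (a * t) x) * ennreal (exp (\<theta> * x)) \<partial>lborel)"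
    by (rule distributed_nn_integral[OF d, symmetric]) measurable
  also have "\<dots> = (\<integral>\<^sup>+x. ennreal k *
      ennreal (indicator {0<..} x * (x powr (a * t - 1) * exp (- (b - \<theta>) * x))) \<partial>lborel)"
  proof (rule nn_integral_cong)
    fix x :: real
    have "gamma_density b (a * t) x * exp (\<theta> * x) =
        k * (indicator {0<..} x * (x powr (a * t - 1) * exp (- (b - \<theta>) * x)))"
      by (simp add: gamma_density_def k_def indicator_def mult_exp_exp algebra_simps)
    then show "ennreal (gamma_density b (a * t) x) * ennreal (exp (\<theta> * x)) = ennreal k *
      ennreal (indicator {0<..} x * (x powr (a * t - 1) * exp (- (b - \<theta>) * x)))"
      using k by (simp only: ennreal_mult'[symmetric] ennreal_mult''[symmetric] exp_ge_zero)
  qed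
  also have "\<dots> = ennreal k *
      (\<integral>\<^sup>+x. ennreal (indicator {0<..} x * (x powr (a * t - 1) * exp (- (b - \<theta>) * x))) \<partial>lborel)"
    by (rule nn_integral_cmult) measurable
  also have "\<dots> < \<infinity>"
    using nn_integral_gamma_kernel_finite[OF at, of "b - \<theta>"] \<theta>
    by (simp add: ennreal_mult_less_top)
  finally show "(\<integral>\<^sup>+\<omega>. ennreal (exp (\<theta> * G t \<omega>)) \<partial>M) < \<infinity>" .
  show "AE \<omega> in M. 0 < G t \<omega>"
    by (subst distributed_AE2[OF d]) (auto simp: gamma_density_def)
qed

text \<open>Conditioning on G_t gives E exp (u L_t) = E exp (\<theta> G_t) with \<theta> =
  \<mu>^\<alpha> - (\<mu> - u)^\<alpha>. By continuity \<theta> tends to 0 with u, so it is below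
  the gamma rate for small u. Nonnegativity is stated at every sample point because measurability of
  a time change by \<open>L\<close> relies on it.\<close>

lemma tempered_mittag_leffler_exp_moment:
  assumes L: "tempered_mittag_leffler_levy_process \<alpha> \<beta>\<^sub>1 lam\<^sub>1 \<mu> L"
    and pos: "0 < \<mu>" "0 < lam\<^sub>1" "0 < \<beta>\<^sub>1" "0 < t"
  shows "\<exists>u>0. (\<integral>\<^sup>+\<omega>. ennreal (exp (u * L t \<omega>)) \<partial>M) < \<infinity>"
    and "AE \<omega> in M. 0 < L t \<omega>"
    and "\<omega> \<in> space M \<Longrightarrow> 0 \<le> L t \<omega>"
proof -
  obtain S G where S: "tempered_stable_subordinator \<alpha> \<mu> S" and G: "gamma_subordinator lam\<^sub>1 \<beta>\<^sub>1 G"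
    and ind: "indep_processes S G" and L: "L = time_change S G"
    using L unfolding tempered_mittag_leffler_levy_process_def by blast
  have subS: "subordinator S" and subG: "subordinator G"
    using S G by (auto simp: tempered_stable_subordinator_def gamma_subordinator_def)
  have t: "0 \<le> t" using pos by simp
  have G0: "0 \<le> G t \<omega>" if "\<omega> \<in> space M" for \<omega>
    using subordinator_nonneg[OF subG that t] .
  then have G0': "AE \<omega> in M. 0 \<le> G t \<omega>" by (intro AE_I2)
  have G1: "AE \<omega> in M. 0 < G t \<omega>"
    by (rule gamma_subordinator_exp_moment(2)[OF G, of _ 0]) (use pos in auto)
  have Lm [measurable]: "L t \<in> borel_measurable M"
    using indep_time_change_measurable[OF ind t subordinator_right_continuous[OF subS] G0]
    unfolding L time_change_def[abs_def] by simp
  show "\<omega> \<in> space M \<Longrightarrow> 0 \<le> L t \<omega>"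
    unfolding L time_change_def using subordinator_nonneg[OF subS] G0 by simp
  have "((\<lambda>u. \<mu> powr \<alpha> - (\<mu> - u) powr \<alpha>) \<longlongrightarrow> \<mu> powr \<alpha> - (\<mu> - 0) powr \<alpha>) (at_right 0)"
    using pos by (intro tendsto_intros) auto
  then have "\<forall>\<^sub>F u in at_right 0. \<mu> powr \<alpha> - (\<mu> - u) powr \<alpha> < lam\<^sub>1"
    using pos by (intro order_tendstoD(2)) auto
  moreover have "\<forall>\<^sub>F u in at_right 0. u \<in> {0<..<\<mu>}"
    using pos by (intro eventually_at_right_real) simp
  ultimately have "\<forall>\<^sub>F u in at_right 0. \<mu> powr \<alpha> - (\<mu> - u) powr \<alpha> < lam\<^sub>1 \<and> 0 < u \<and> u < \<mu>"
    by eventually_elim auto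
  then obtain u where u: "\<mu> powr \<alpha> - (\<mu> - u) powr \<alpha> < lam\<^sub>1" "0 < u" "u < \<mu>"
    using eventually_happens[of _ "at_right (0::real)"] by (auto simp: trivial_limit_at_right_real)
  define \<theta> where "\<theta> = \<mu> powr \<alpha> - (\<mu> - u) powr \<alpha>"
  show "\<exists>u>0. (\<integral>\<^sup>+\<omega>. ennreal (exp (u * L t \<omega>)) \<partial>M) < \<infinity>"
  proof (intro exI conjI)
    have f: "(\<lambda>x. ennreal (exp (u * x))) \<in> borel_measurable borel" by measurable
    obtain h where "h \<in> borel_measurable borel"
      and h: "\<And>y. 0 \<le> y \<Longrightarrow> h y = (\<integral>\<^sup>+\<omega>. ennreal (exp (u * S y \<omega>)) \<partial>M)"
      and eq: "(\<integral>\<^sup>+\<omega>. ennreal (exp (u * S (G t \<omega>) \<omega>)) \<partial>M) = (\<integral>\<^sup>+\<omega>. h (G t \<omega>) \<partial>M)"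
      by (rule indep_time_change_nn_integral[OF ind t subordinator_right_continuous[OF subS] G0' f]) (assumption | rule that)+
    have "(\<integral>\<^sup>+\<omega>. h (G t \<omega>) \<partial>M) = (\<integral>\<^sup>+\<omega>. ennreal (exp (\<theta> * G t \<omega>)) \<partial>M)"
      by (rule nn_integral_cong_AE, rule AE_mp[OF G1])
        (simp add: h \<theta>_def tempered_stable_exp_moment(1)[OF S _ less_imp_le[OF u(3)]])
    also have "\<dots> < \<infinity>"
      using gamma_subordinator_exp_moment(1)[OF G _ _ u(1)] pos by (simp add: \<theta>_def)
    finally show "(\<integral>\<^sup>+\<omega>. ennreal (exp (u * L t \<omega>)) \<partial>M) < \<infinity>"
      unfolding L time_change_def eq .
  qed (rule u(2))
  show "AE \<omega> in M. 0 < L t \<omega>"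
  proof -
    \<comment> \<open>Positivity becomes a vanishing expectation of an indicator, to which the time
      change formula applies: P(S_y \<le> 0) = 0 for y > 0, and G_t > 0 almost surely.\<close>
    have f: "(\<lambda>x::real. indicator {..0} x :: ennreal) \<in> borel_measurable borel" by measurable
    obtain h where "h \<in> borel_measurable borel"
      and h: "\<And>y. 0 \<le> y \<Longrightarrow> h y = (\<integral>\<^sup>+\<omega>. indicator {..0} (S y \<omega>) \<partial>M)"
      and eq: "(\<integral>\<^sup>+\<omega>. indicator {..0} (S (G t \<omega>) \<omega>) \<partial>M) = (\<integral>\<^sup>+\<omega>. h (G t \<omega>) \<partial>M)"
      by (rule indep_time_change_nn_integral[OF ind t subordinator_right_continuous[OF subS] G0' f]) (assumption | rule that)+
    have h0: "h y = 0" if y: "0 < y" for y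
    proof -
      have "(\<integral>\<^sup>+\<omega>. indicator {..0} (S y \<omega>) \<partial>M) = (\<integral>\<^sup>+\<omega>. 0 \<partial>M)"
        by (rule nn_integral_cong_AE, rule AE_mp[OF tempered_stable_exp_moment(2)[OF S y order_refl]])
          (simp add: indicator_def)
      then show ?thesis using h[of y] y by simp
    qed
    have "(\<integral>\<^sup>+\<omega>. h (G t \<omega>) \<partial>M) = (\<integral>\<^sup>+\<omega>. 0 \<partial>M)"
      by (rule nn_integral_cong_AE, rule AE_mp[OF G1]) (simp add: h0)
    with eq have "(\<integral>\<^sup>+\<omega>. indicator {..0} (L t \<omega>) \<partial>M) = 0"
      by (simp add: L time_change_def)
    then have "AE \<omega> in M. indicator {..0} (L t \<omega>) = (0::ennreal)"
      by (subst (asm) nn_integral_0_iff_AE) auto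
    then show ?thesis by eventually_elim (auto simp: indicator_def split: if_splits)
  qed
qed

section \<open>Overdispersion of the time-changed process\<close>

text \<open>Let a and b be the conditional first and second moments of Q_t given L_t, so that a +
  a^2 < b almost surely. Then Var Q_t = E b - (E a)^2 \<ge> E b - E a^2 > E a = E Q_t.\<close>

lemma tstfnb_process_overdispersed:
  assumes Q: "tstfnb_process \<alpha> \<beta> \<beta>\<^sub>1 lam\<^sub>1 \<mu> lam Q"
    and \<beta>: "0 < \<beta>" "\<beta> < 1" and pos: "0 < \<mu>" "0 < lam\<^sub>1" "0 < \<beta>\<^sub>1" "0 < lam" and t: "0 < t"
  shows "expectation (\<lambda>\<omega>. real (Q t \<omega>)) < variance (\<lambda>\<omega>. real (Q t \<omega>))"
proof -
  obtain F L where F: "fractional_poisson_process \<beta> lam F"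
    and L: "tempered_mittag_leffler_levy_process \<alpha> \<beta>\<^sub>1 lam\<^sub>1 \<mu> L"
    and ind: "indep_processes (\<lambda>t \<omega>. real (F t \<omega>)) L" and Q: "Q = time_change F L"
    using Q unfolding tstfnb_process_def by blast
  note Lfacts = tempered_mittag_leffler_exp_moment[OF L pos(1-3) t]
  have t0: "0 \<le> t" using t by simp
  have L0: "AE \<omega> in M. 0 \<le> L t \<omega>" using Lfacts(3) by (intro AE_I2)
  have [measurable]: "L t \<in> borel_measurable M" by (rule indep_processes_measurable(2)[OF ind t0])
  define X where "X \<omega> = real (F (L t \<omega>) \<omega>)" for \<omega>
  have X: "real (Q t \<omega>) = X \<omega>" for \<omega> by (simp add: X_def Q time_change_def)
  have [measurable]: "X \<in> borel_measurable M"
    unfolding X_def[abs_def]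
    by (rule indep_time_change_measurable[OF ind t0
          fractional_poisson_process_right_continuous[OF F] Lfacts(3)])
  obtain hA where [measurable]: "hA \<in> borel_measurable borel"
    and hA: "\<And>y. 0 \<le> y \<Longrightarrow> hA y = (\<integral>\<^sup>+\<omega>. ennreal (real (F y \<omega>)) \<partial>M)"
    and XA: "(\<integral>\<^sup>+\<omega>. ennreal (real (F (L t \<omega>) \<omega>)) \<partial>M) = (\<integral>\<^sup>+\<omega>. hA (L t \<omega>) \<partial>M)"
    by (rule indep_time_change_nn_integral[OF ind t0
          fractional_poisson_process_right_continuous[OF F] L0 measurable_ennreal]) (assumption | rule that)+
  have sq: "(\<lambda>x::real. ennreal (x\<^sup>2)) \<in> borel_measurable borel" by measurable
  obtain hB where [measurable]: "hB \<in> borel_measurable borel"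
    and hB: "\<And>y. 0 \<le> y \<Longrightarrow> hB y = (\<integral>\<^sup>+\<omega>. ennreal ((real (F y \<omega>))\<^sup>2) \<partial>M)"
    and XB: "(\<integral>\<^sup>+\<omega>. ennreal ((real (F (L t \<omega>) \<omega>))\<^sup>2) \<partial>M) = (\<integral>\<^sup>+\<omega>. hB (L t \<omega>) \<partial>M)"
    by (rule indep_time_change_nn_integral[OF ind t0
          fractional_poisson_process_right_continuous[OF F] L0 sq]) (assumption | rule that)+
  note XA = XA[folded X_def] and XB = XB[folded X_def]
  \<comment> \<open>The value 0 that \<open>enn2real\<close> gives to infinity occurs only on a null
    set: both moments are finite when L_t > 0.\<close>
  define a b where "a \<omega> = enn2real (hA (L t \<omega>))" and "b \<omega> = enn2real (hB (L t \<omega>))" for \<omega>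
  have [measurable]: "a \<in> borel_measurable M" "b \<in> borel_measurable M"
    unfolding a_def[abs_def] b_def[abs_def] by measurable
  have ab0: "0 \<le> a \<omega>" "0 \<le> b \<omega>" for \<omega> by (simp_all add: a_def b_def)
  have ab: "AE \<omega> in M. hA (L t \<omega>) = ennreal (a \<omega>) \<and> hB (L t \<omega>) = ennreal (b \<omega>) \<and> a \<omega> + (a \<omega>)\<^sup>2 < b \<omega>"
    using Lfacts(2)
  proof eventually_elim
    case (elim \<omega>)
    obtain a' b' where "0 \<le> a'" "0 \<le> b'" "hA (L t \<omega>) = ennreal a'" "hB (L t \<omega>) = ennreal b'"
      "a' + a'\<^sup>2 < b'"
      using fractional_poisson_process_moments(2)[OF F \<beta> pos(4) elim] hA hB elim
      by (metis less_imp_le)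
    then show ?case by (simp add: a_def b_def)
  qed
  have XA': "(\<integral>\<^sup>+\<omega>. ennreal (X \<omega>) \<partial>M) = (\<integral>\<^sup>+\<omega>. ennreal (a \<omega>) \<partial>M)"
    unfolding XA by (rule nn_integral_cong_AE, rule AE_mp[OF ab]) simp
  have XB': "(\<integral>\<^sup>+\<omega>. ennreal ((X \<omega>)\<^sup>2) \<partial>M) = (\<integral>\<^sup>+\<omega>. ennreal (b \<omega>) \<partial>M)"
    unfolding XB by (rule nn_integral_cong_AE, rule AE_mp[OF ab]) simp
  obtain u where u: "0 < u" "(\<integral>\<^sup>+\<omega>. ennreal (exp (u * L t \<omega>)) \<partial>M) < \<infinity>"
    using Lfacts(1) by blast
  obtain C where C: "0 \<le> C"
    "\<And>y. 0 \<le> y \<Longrightarrow> (\<integral>\<^sup>+\<omega>. ennreal ((real (F y \<omega>))\<^sup>2) \<partial>M) \<le> ennreal (C * exp (u * y))"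
    using fractional_poisson_process_moments(1)[OF F \<beta> pos(4) u(1)] by blast
  \<comment> \<open>The rate \<open>u\<close> comes from the exponential moment of L_t, and
    \<open>C\<close> is then chosen for this \<open>u\<close>; so the second moment of Q_t is
    finite.\<close>
  have "(\<integral>\<^sup>+\<omega>. hB (L t \<omega>) \<partial>M) \<le> (\<integral>\<^sup>+\<omega>. ennreal C * ennreal (exp (u * L t \<omega>)) \<partial>M)"
    by (rule nn_integral_mono_AE, rule AE_mp[OF L0]) (simp add: hB C ennreal_mult[symmetric])
  also have "\<dots> = ennreal C * (\<integral>\<^sup>+\<omega>. ennreal (exp (u * L t \<omega>)) \<partial>M)"
    by (rule nn_integral_cmult) measurable
  also have "\<dots> < \<infinity>" using u(2) by (simp add: ennreal_mult_less_top)
  finally have fin: "(\<integral>\<^sup>+\<omega>. hB (L t \<omega>) \<partial>M) < \<infinity>" .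
  have IX2: "integrable M (\<lambda>\<omega>. (X \<omega>)\<^sup>2)"
    using fin XB by (intro integrableI_nonneg) auto
  have IX: "integrable M X"
    by (rule square_integrable_imp_integrable[OF _ IX2]) measurable
  have Ib: "integrable M b"
    using fin XB XB' ab0 by (intro integrableI_nonneg) auto
  \<comment> \<open>Finiteness of E b carries over to E a^2, since a^2 < b almost surely.\<close>
  have Ia2: "integrable M (\<lambda>\<omega>. (a \<omega>)\<^sup>2)"
  proof (rule Bochner_Integration.integrable_bound[OF Ib])
    show "AE \<omega> in M. norm ((a \<omega>)\<^sup>2) \<le> norm (b \<omega>)"
      using ab
    proof eventually_elim
      case (elim \<omega>)
      with ab0[of \<omega>] show ?case by simp
    qed
  qed measurable
  have Ia: "integrable M a"
    by (rule square_integrable_imp_integrable[OF _ Ia2]) measurable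
  have Xnn: "0 \<le> X \<omega>" for \<omega> by (simp add: X_def)
  have EX: "expectation X = expectation a"
    using XA' ab0 Xnn by (simp add: integral_eq_nn_integral)
  have EX2: "expectation (\<lambda>\<omega>. (X \<omega>)\<^sup>2) = expectation b"
    using XB' ab0 by (simp add: integral_eq_nn_integral)
  \<comment> \<open>Jensen's inequality for the square, in the form that the variance of
    \<open>a\<close> is nonnegative.\<close>
  have "(expectation a)\<^sup>2 \<le> expectation (\<lambda>\<omega>. (a \<omega>)\<^sup>2)"
    using variance_positive[of a] variance_eq[OF Ia Ia2] by simp
  \<comment> \<open>Strictness survives integration because the inequality is strict almost
    everywhere on a space of mass 1.\<close>
  moreover have "expectation (\<lambda>\<omega>. a \<omega> + (a \<omega>)\<^sup>2) < expectation b"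
  proof (rule integral_less_AE_space)
    show "AE \<omega> in M. a \<omega> + (a \<omega>)\<^sup>2 < b \<omega>"
      using ab by eventually_elim simp
  qed (use Ia Ia2 Ib in \<open>auto simp: emeasure_space_1\<close>)
  moreover have "variance X = expectation b - (expectation a)\<^sup>2"
    by (subst variance_eq[OF IX IX2]) (simp add: EX EX2)
  ultimately show ?thesis
    unfolding X using EX Ia Ia2 by simp
qed

end

theorem mainTheorem5:
  fixes P :: "'a measure" and \<alpha> \<beta> \<beta>\<^sub>1 lam\<^sub>1 \<mu> lam :: real
    and Q :: "real \<Rightarrow> 'a \<Rightarrow> nat"
  assumes "prob_space P"
    and "0 < \<alpha>" "\<alpha> < 1" "0 < \<beta>" "\<beta> < 1"
    and "0 < \<mu>" "0 < lam\<^sub>1" "0 < \<beta>\<^sub>1" "0 < lam"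
    and "prob_space.tstfnb_process P \<alpha> \<beta> \<beta>\<^sub>1 lam\<^sub>1 \<mu> lam Q"
  shows "\<forall>t>0. prob_space.variance P (\<lambda>\<omega>. real (Q t \<omega>))
                - prob_space.expectation P (\<lambda>\<omega>. real (Q t \<omega>)) > 0"
  using prob_space.tstfnb_process_overdispersed[OF assms(1,10)] assms by simp

end
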